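(* Let $D\ge1$, $T\ge 1$, $\eta>0$, and let $L:\mathbb{R}^D\to\mathbb{R}$ be a function, $\theta_0\in\mathbb{R}^D$, and $\theta_{t+1}=\theta_t-\eta\nabla L(\theta_t)$ for $0\le t\le T-1$. Suppose that on an open convex set containing $\theta_0,\dots,\theta_{T-1}$ the function $L$ is quadratic with constant (symmetric) Hessian $H\in\mathbb{R}^{D\times D}$. Write $g_t=\nabla L(\theta_t)$. Then $g_t=(I-\eta H)^t g_0$ for $0\le t\le T-1$, and $$\theta_T-\theta_0=-\eta\sum_{t=0}^{T-1}g_t\;\in\;\mathcal{K}_T(H,g_0):=\operatorname{span}\{g_0,Hg_0,\dots,H^{T-1}g_0\}.$$ Moreover, a direction (nonzero vector) $u\in\mathbb{R}^D$ is invariant under one step if and only if $Hu\parallel u$, and a linear subspace $U\subseteq\mathbb{R}^D$ is invariant under one step if and only if $HU\subseteq U$.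
   Context: $I$ is the $D\times D$ identity matrix. "One step" refers to the linear map $v\mapsto(I-\eta H)v$ by which gradients evolve under one gradient-descent step. A direction $u\ne 0$ is invariant under one step if $(I-\eta H)u\in\operatorname{span}\{u\}$; a subspace $U$ is invariant under one step if $(I-\eta H)U\subseteq U$. The notation $Hu\parallel u$ means $Hu\in\operatorname{span}\{u\}$ (so $Hu=0$ is allowed). In the source, $L=L_\tau$ is a task loss and $\theta_0,\dots,\theta_T$ is the gradient-descent "recovery window". *)

theory Defs
  imports "HOL-Analysis.Analysis"
begin

definition gradient :: "('a::real_inner \<Rightarrow> real) \<Rightarrow> 'a \<Rightarrow> 'a" where
  "gradient f x = (THE g. GDERIV f x :> g)"

(* The differentiability condition near x makes the values of the gradient there meaningful. *)
definition has_hessian :: "(real^'n \<Rightarrow> real) \<Rightarrow> real^'n^'n \<Rightarrow> real^'n \<Rightarrow> bool" where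
  "has_hessian f H x \<longleftrightarrow>
     (\<forall>\<^sub>F y in nhds x. f differentiable (at y)) \<and>
     (gradient f has_derivative (\<lambda>v. H *v v)) (at x)"

(* Polynomial of degree at most 2: affine functions are included. *)
definition quadratic_on :: "(real^'n) set \<Rightarrow> (real^'n \<Rightarrow> real) \<Rightarrow> bool" where
  "quadratic_on S f \<longleftrightarrow>
     (\<exists>(A::real^'n^'n) b c. \<forall>x\<in>S. f x = x \<bullet> (A *v x) + b \<bullet> x + c)"

(* The power operator on real^'n^'n is componentwise, so it is not the matrix power. *)
primrec matpow :: "real^'n^'n \<Rightarrow> nat \<Rightarrow> real^'n^'n" where
  "matpow A 0 = mat 1"
| "matpow A (Suc k) = A ** matpow A k"

definition krylov :: "nat \<Rightarrow> real^'n^'n \<Rightarrow> real^'n \<Rightarrow> (real^'n) set" where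
  "krylov T H g = span ((\<lambda>k. matpow H k *v g) ` {..<T})"

definition one_step :: "real \<Rightarrow> real^'n^'n \<Rightarrow> real^'n \<Rightarrow> real^'n" where
  "one_step \<eta> H v = (mat 1 - \<eta> *\<^sub>R H) *v v"

definition invariant_direction :: "real \<Rightarrow> real^'n^'n \<Rightarrow> real^'n \<Rightarrow> bool" where
  "invariant_direction \<eta> H u \<longleftrightarrow> one_step \<eta> H u \<in> span {u}"

definition invariant_subspace :: "real \<Rightarrow> real^'n^'n \<Rightarrow> (real^'n) set \<Rightarrow> bool" where
  "invariant_subspace \<eta> H U \<longleftrightarrow> one_step \<eta> H ` U \<subseteq> U"

definition parallel :: "real^'n \<Rightarrow> real^'n \<Rightarrow> bool" where
  "parallel w u \<longleftrightarrow> w \<in> span {u}"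

end

theory Submission
  imports Defs
begin

text \<open>On \<open>S\<close> the map \<open>gradient L\<close> has constant derivative
  \<open>H\<close>, so by convexity it is affine with linear part \<open>H\<close>
  (\<open>gradient_diff\<close>). A descent step moves the iterate by
  \<open>- \<eta> *\<^sub>R g t\<close>, hence changes the gradient by
  \<open>- \<eta> *\<^sub>R (H *v g t)\<close>: gradients evolve under I - \<eta>H, and induction
  gives the power formula. A polynomial of degree t in H applied to \<open>g 0\<close> lies in the
  Krylov space of order t + 1 (\<open>matpow_one_step_mem_krylov\<close>), and the displacement is a
  combination of such vectors with t < T. The invariance claims hold because I - \<eta>H and H
  differ by a nonzero scaling and a multiple of the identity, so they preserve the same subspaces
  (\<open>one_step_mem_subspace_iff\<close>).\<close>

lemma one_step_eq: "one_step \<eta> H v = v - \<eta> *\<^sub>R (H *v v)"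
  by (simp add: one_step_def matrix_vector_mult_diff_rdistrib scaleR_matrix_vector_assoc)

text \<open>Since \<eta> is nonzero, each of the two vectors is a linear combination of
  \<open>u\<close> and the other; in particular Hu is u minus its image, divided by \<eta>.\<close>

lemma one_step_mem_subspace_iff:
  assumes "subspace U" "u \<in> U" "\<eta> \<noteq> 0"
  shows "one_step \<eta> H u \<in> U \<longleftrightarrow> H *v u \<in> U"
proof
  assume "one_step \<eta> H u \<in> U"
  then have "inverse \<eta> *\<^sub>R (u - one_step \<eta> H u) \<in> U"
    using assms by (intro subspace_scale subspace_diff)
  then show "H *v u \<in> U"
    using assms(3) by (simp add: one_step_eq)
next
  assume "H *v u \<in> U"
  then show "one_step \<eta> H u \<in> U"
    unfolding one_step_eq using assms by (intro subspace_scale subspace_diff)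
qed

lemma invariant_subspace_iff:
  assumes "subspace U" "\<eta> \<noteq> 0"
  shows "invariant_subspace \<eta> H U \<longleftrightarrow> (\<lambda>v. H *v v) ` U \<subseteq> U"
  using one_step_mem_subspace_iff[OF assms(1) _ assms(2)]
  by (auto simp: invariant_subspace_def image_subset_iff)

text \<open>This is the pointwise criterion for the line \<open>span {u}\<close>.\<close>

lemma invariant_direction_iff:
  assumes "\<eta> \<noteq> 0"
  shows "invariant_direction \<eta> H u \<longleftrightarrow> parallel (H *v u) u"
  unfolding invariant_direction_def parallel_def
  using assms by (intro one_step_mem_subspace_iff) (auto intro: span_base)

text \<open>Subtracting the linear map H from the gradient leaves a map with zero derivative, which
  is constant on a convex set.\<close>

lemma gradient_diff:
  assumes "convex S" and hess: "\<And>x. x \<in> S \<Longrightarrow> has_hessian f H x"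
    and "x \<in> S" "y \<in> S"
  shows "gradient f y - gradient f x = H *v (y - x)"
proof -
  have "((\<lambda>z. gradient f z - H *v z) has_derivative (\<lambda>v. 0)) (at z within S)"
    if "z \<in> S" for z
  proof -
    have "((*v) H has_derivative (*v) H) (at z within S)"
      by (intro bounded_linear_imp_has_derivative matrix_vector_mul_bounded_linear)
    moreover have "(gradient f has_derivative (*v) H) (at z within S)"
      using hess[OF that] by (auto simp: has_hessian_def intro: has_derivative_at_withinI)
    ultimately show ?thesis
      by (auto dest: has_derivative_diff)
  qed
  from has_derivative_zero_constant[OF assms(1) this] obtain c
    where c: "\<And>z. z \<in> S \<Longrightarrow> gradient f z - H *v z = c"
    by blast
  have "gradient f y - H *v y = gradient f x - H *v x"
    using assms(3,4) c by simp
  then show ?thesis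
    by (simp add: matrix_vector_mult_diff_distrib algebra_simps)
qed

lemma subspace_krylov: "subspace (krylov T H v)"
  by (simp add: krylov_def)

lemma krylov_mono: "m \<le> n \<Longrightarrow> krylov m H v \<subseteq> krylov n H v"
  unfolding krylov_def by (intro span_mono image_mono) auto

text \<open>A linear map commutes with taking spans, so only generators matter, and H sends the k-th
  one to the one of index k + 1.\<close>

lemma mult_mem_krylov_Suc:
  assumes "w \<in> krylov T H v"
  shows "H *v w \<in> krylov (Suc T) H v"
proof -
  have "(*v) H ` krylov T H v = span ((*v) H ` (\<lambda>k. matpow H k *v v) ` {..<T})"
    unfolding krylov_def
    by (rule linear_span_image[symmetric]) (rule matrix_vector_mul_linear)
  also have "\<dots> \<subseteq> krylov (Suc T) H v"
    unfolding krylov_def image_image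
    by (rule span_mono, clarsimp, rename_tac k, rule_tac x = "Suc k" in image_eqI)
      (simp_all add: matrix_vector_mul_assoc)
  finally show ?thesis
    using assms by blast
qed

lemma matpow_one_step_mem_krylov:
  "matpow (mat 1 - \<eta> *\<^sub>R H) t *v v \<in> krylov (Suc t) H v"
proof (induction t)
  case 0
  have "v \<in> (\<lambda>k. matpow H k *v v) ` {..<Suc 0}"
    by (rule image_eqI[of _ _ 0]) simp_all
  then show ?case
    by (simp add: krylov_def span_base)
next
  case (Suc t)
  let ?w = "matpow (mat 1 - \<eta> *\<^sub>R H) t *v v"
  \<comment> \<open>\<open>?w\<close> itself and its image under H both have to lie in the larger
    space before they can be combined.\<close>
  have "?w \<in> krylov (Suc (Suc t)) H v"
    using Suc krylov_mono[of "Suc t" "Suc (Suc t)"] by auto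
  then have "?w - \<eta> *\<^sub>R (H *v ?w) \<in> krylov (Suc (Suc t)) H v"
    by (intro subspace_diff subspace_scale subspace_krylov mult_mem_krylov_Suc Suc)
  then have "one_step \<eta> H ?w \<in> krylov (Suc (Suc t)) H v"
    by (simp only: one_step_eq)
  then show ?case
    by (simp add: one_step_def matrix_vector_mul_assoc)
qed

theorem lemma1:
  fixes L :: "real^'n \<Rightarrow> real" and H :: "real^'n^'n"
    and \<theta> g :: "nat \<Rightarrow> real^'n" and \<eta> :: real and T :: nat and S :: "(real^'n) set"
  assumes "T \<ge> 1" and "\<eta> > 0"
    and "\<And>t. t < T \<Longrightarrow> \<theta> (Suc t) = \<theta> t - \<eta> *\<^sub>R gradient L (\<theta> t)"
    and "open S" and "convex S" and "\<And>t. t < T \<Longrightarrow> \<theta> t \<in> S"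
    and "quadratic_on S L"
    and "transpose H = H" and "\<And>x. x \<in> S \<Longrightarrow> has_hessian L H x"
    and "\<And>t. t < T \<Longrightarrow> g t = gradient L (\<theta> t)"
  shows "(\<forall>t<T. g t = matpow (mat 1 - \<eta> *\<^sub>R H) t *v g 0) \<and>
    \<theta> T - \<theta> 0 = - \<eta> *\<^sub>R (\<Sum>t<T. g t) \<and>
    \<theta> T - \<theta> 0 \<in> krylov T H (g 0) \<and>
    (\<forall>u. u \<noteq> 0 \<longrightarrow> (invariant_direction \<eta> H u \<longleftrightarrow> parallel (H *v u) u)) \<and>
    (\<forall>U. subspace U \<longrightarrow> (invariant_subspace \<eta> H U \<longleftrightarrow> (\<lambda>v. H *v v) ` U \<subseteq> U))"
proof (intro conjI allI impI)
  have step: "\<theta> (Suc t) = \<theta> t - \<eta> *\<^sub>R g t" if "t < T" for t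
    using assms(3,10) that by simp
  show g_eq: "g t = matpow (mat 1 - \<eta> *\<^sub>R H) t *v g 0" if "t < T" for t
    using that
  proof (induction t)
    case 0
    then show ?case by simp
  next
    case (Suc t)
    \<comment> \<open>\<open>Suc t < T\<close> puts both iterates in \<open>S\<close>; the final
      point \<open>\<theta> T\<close> is not assumed to lie there.\<close>
    have "g (Suc t) - g t = H *v (\<theta> (Suc t) - \<theta> t)"
      using gradient_diff[OF assms(5,9)] assms(6,10) Suc.prems by simp
    also have "\<dots> = - \<eta> *\<^sub>R (H *v g t)"
      using step Suc.prems matrix_vector_mult_scaleR[of H "- \<eta>" "g t"] by simp
    finally have "g (Suc t) = one_step \<eta> H (g t)"
      by (simp add: one_step_eq algebra_simps)
    then show ?case
      using Suc by (simp add: one_step_def matrix_vector_mul_assoc)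
  qed
  \<comment> \<open>The telescoping sum is proved for every \<open>n\<close> up to \<open>T\<close>,
    so that the induction stays where \<open>step\<close> applies.\<close>
  have "\<theta> n - \<theta> 0 = - \<eta> *\<^sub>R (\<Sum>t<n. g t)" if "n \<le> T" for n
    using that by (induction n) (simp_all add: step algebra_simps)
  then show sum_eq: "\<theta> T - \<theta> 0 = - \<eta> *\<^sub>R (\<Sum>t<T. g t)"
    by simp
  \<comment> \<open>Here t < T means \<open>Suc t \<le> T\<close>, so the Krylov space of order t +
    1 is contained in that of order T.\<close>
  have "g t \<in> krylov T H (g 0)" if "t < T" for t
    using that g_eq[OF that] matpow_one_step_mem_krylov[of \<eta> H t "g 0"]
      krylov_mono[of "Suc t" T H "g 0"]
    by auto
  then show "\<theta> T - \<theta> 0 \<in> krylov T H (g 0)"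
    unfolding sum_eq by (intro subspace_scale subspace_sum subspace_krylov) auto
  show "invariant_direction \<eta> H u \<longleftrightarrow> parallel (H *v u) u" for u
    using assms(2) by (simp add: invariant_direction_iff)
  show "invariant_subspace \<eta> H U \<longleftrightarrow> (\<lambda>v. H *v v) ` U \<subseteq> U" if "subspace U" for U
    using assms(2) that by (simp add: invariant_subspace_iff)
qed

end
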